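(* Let $A=(B,O,S)$ be an abduction instance, and let $P_{bos}(A)=P_b\cup P_o\cup P_s$ be the ASP rewriting of its axioms, observation and sort names, as defined in the context. Let $$P_{bpt}(A)=P_{bos}(A)\cup\{\ pot(X)\leftarrow goal(X).\ ,\quad pot(P)\leftarrow inferenceNeeds(\_,\_,P).\ \}.$$ Then $P_{bpt}(A)$ has a single answer set $I$, and $I$ represents the union of all proof graphs of all hypotheses of $A$ that are generated by back-chaining, with nodes $\{P \mid pot(P)\in I\}$ and edges $$\{(Q,P)\mid mayInferVia(R,P,L)\in I,\ inferenceNeeds(P,R,Q)\in I\}.$$
   Context: **Abduction instances.** An abduction instance is a tuple $A=(B,O,S)$. Here $O$ (observation, goal) is an existentially quantified conjunction of atoms $\exists V_1,\dots,V_k: o_1(V_1,\dots,V_k)\wedge\cdots\wedge o_m(V_1,\dots,V_k)$, also regarded as a set of atoms, in which each existential variable $V_i$ is represented by a constant $v_i\notin S$. $B$ is a finite set of axioms, each a single-head Horn clause $$q(Y_1,\dots,Y_m)\Leftarrow p_1(X^1_1,\dots,X^1_{k_1})\wedge\cdots\wedge p_r(X^r_1,\dots,X^r_{k_r}),$$ with body variables $\mathcal X$, head variables $\mathcal Y\subseteq\mathcal X$, universally quantified over $\mathcal X$ (constants may also occur as arguments; they are left unchanged by the rewriting, and only head variables are arguments of Skolem terms). $S$ is a set of constants of $B$ called sort names. $B$ is assumed acyclic: no circular inferences are possible over the axioms. **Hypotheses.** A hypothesis is a conjunction of atoms and equalities between terms. The set $\hat{\mathcal H}(A)$ of all hypotheses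 of $A$ is obtained from $\{O\}$ by closing under two operations. *Back-chaining*: given an atom $P$ in a hypothesis $H$ that unifies via $\theta$ with the head of an axiom, add the hypothesis $H\wedge P_1'\wedge\cdots\wedge P_r'$ with $P_i'=\theta(p_i(X^i_1,\dots,X^i_{k_i}))$, where body variables not in the head are existential and are replaced by Skolem terms (value invention). *Unification*: given distinct atoms $P,Q\in H$ unifying under $\theta$ such that all $X\mapsto Y\in\theta$ obey $X,Y\notin S$, add $H\wedge\bigwedge\{X=Y\mid X\mapsto Y\in\theta\}$. Hypotheses generated by back-chaining are those for which only back-chaining is used. **Proof graphs.** A proof graph $G$ wrt. $H\in\hat{\mathcal H}(A)$ is an acyclic directed graph with nodes $N(G)=\{P\in H\mid P\text{ is not an equality}\}$ and edges $E(G)$ defined by the inference operations used to generate the atoms of $H$: back-chaining of $P$ induces an edge from each body atom $P_i'$ to $P$; unification of $P$ with $Q$ induces either an edge from $P$ to $Q$ or an edge from $Q$ to $P$. **ASP rewriting.** An atom $p(a,b)$ (or of other arity) is represented by the term $c(p,a,b)$. - $P_o$ contains the fact $goal(c(o_i,v_1,\dots,v_k))$ for each atom of $O$. - $P_s$ contains the fact $sortname(s)$ for each $s\in S$. - $P_b$ contains, for each axiom with unique identifier $a$ and with $\{Z_1,\dots,Z_v\}=\mathcal X\setminus\mathcal Y$, the rules $$mayInferVia(a,c(q,Y_1,\dots,Y_m),l(Z_1,\dots,Z_v))\leftarrow pot(c(q,Y_1,\dots,Y_m)),\ Z_1=s(a,1,Y_1,\dots,Y_m),\dots,Z_v=s(a,v,Y_1,\dots,Y_m).$$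 $$inferenceNeeds(c(q,Y_1,\dots,Y_m),a,c(p_i,X^i_1,\dots,X^i_{k_i}))\leftarrow mayInferVia(a,c(q,Y_1,\dots,Y_m),l(Z_1,\dots,Z_v)).\quad (1\le i\le r)$$ where $s$, $l$, $c$ are uninterpreted function symbols. Answer sets are those of the standard ASP (stable model) semantics; $\_$ denotes an anonymous variable. *)

theory Defs
  imports Main
begin

datatype ('p, 't) atom = Atom (pred: 'p) (args: "'t list")

datatype ('f, 'v) asp_term = AVar 'v | AFun 'f "('f, 'v) asp_term list"

primrec asp_subst :: "('v \<Rightarrow> ('f, 'w) asp_term) \<Rightarrow> ('f, 'v) asp_term \<Rightarrow> ('f, 'w) asp_term" where
  "asp_subst \<sigma> (AVar x) = \<sigma> x"
| "asp_subst \<sigma> (AFun f ts) = AFun f (map (asp_subst \<sigma>) ts)"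

primrec asp_vars :: "('f, 'v) asp_term \<Rightarrow> 'v set" where
  "asp_vars (AVar x) = {x}"
| "asp_vars (AFun f ts) = \<Union> (set (map asp_vars ts))"

text \<open>Function symbols are counted together with their arity; constants have arity 0.\<close>

primrec asp_syms :: "('f, 'v) asp_term \<Rightarrow> ('f \<times> nat) set" where
  "asp_syms (AVar x) = {}"
| "asp_syms (AFun f ts) = insert (f, length ts) (\<Union> (set (map asp_syms ts)))"

datatype ('r, 't) literal =
    Pos "('r, 't) atom"
  | Naf "('r, 't) atom"
  | Equal 't 't

text \<open>The set function \<open>rule_terms\<close> collects the argument terms of all atoms and both sides of
  all equalities of a rule, and \<open>map_rule id g\<close> applies \<open>g\<close> to each of them.\<close>

datatype ('r, rule_terms: 't) rule =
  Rule (rule_head: "('r, 't) atom") (rule_body: "('r, 't) literal list")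

type_synonym ('r, 'f, 'v) program = "('r, ('f, 'v) asp_term) rule set"
type_synonym ('r, 'f, 'v) asp_interp = "('r, ('f, 'v) asp_term) atom set"

definition rule_vars :: "('r, ('f, 'v) asp_term) rule \<Rightarrow> 'v set" where
  "rule_vars r = (\<Union>t\<in>rule_terms r. asp_vars t)"

definition program_syms :: "('r, 'f, 'v) program \<Rightarrow> ('f \<times> nat) set" where
  "program_syms \<Pi> = (\<Union>r\<in>\<Pi>. \<Union>t\<in>rule_terms r. asp_syms t)"

text \<open>As usual, an arbitrary constant is added if the program contains none.\<close>

definition signature :: "('r, 'f, 'v) program \<Rightarrow> ('f \<times> nat) set" where
  "signature \<Pi> =
    (if \<exists>f. (f, 0) \<in> program_syms \<Pi> then program_syms \<Pi>
     else insert (undefined, 0) (program_syms \<Pi>))"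

inductive_set herbrand_universe :: "('r, 'f, 'v) program \<Rightarrow> ('f, 'v) asp_term set"
  for \<Pi> :: "('r, 'f, 'v) program" where
  "\<lbrakk>(f, length ts) \<in> signature \<Pi>; \<forall>t\<in>set ts. t \<in> herbrand_universe \<Pi>\<rbrakk>
    \<Longrightarrow> AFun f ts \<in> herbrand_universe \<Pi>"

definition grounding :: "('r, 'f, 'v) program \<Rightarrow> ('r, 'f, 'v) program" where
  "grounding \<Pi> =
    {map_rule id (asp_subst \<sigma>) r | r \<sigma>. r \<in> \<Pi> \<and> (\<forall>x\<in>rule_vars r. \<sigma> x \<in> herbrand_universe \<Pi>)}"

text \<open>Gelfond-Lifschitz reduct of the grounding, as pairs of a head and a positive body.
  A ground equality is built in and holds iff both sides are the same term.\<close>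

definition reduct ::
  "('r, 'f, 'v) program \<Rightarrow> ('r, 'f, 'v) asp_interp
    \<Rightarrow> (('r, ('f, 'v) asp_term) atom \<times> ('r, 'f, 'v) asp_interp) set" where
  "reduct \<Pi> I =
    {(rule_head r, {a. Pos a \<in> set (rule_body r)}) | r.
       r \<in> grounding \<Pi> \<and>
       (\<forall>a. Naf a \<in> set (rule_body r) \<longrightarrow> a \<notin> I) \<and>
       (\<forall>s t. Equal s t \<in> set (rule_body r) \<longrightarrow> s = t)}"

definition is_model :: "'a set \<Rightarrow> ('a \<times> 'a set) set \<Rightarrow> bool" where
  "is_model I D \<longleftrightarrow> (\<forall>(h, b)\<in>D. b \<subseteq> I \<longrightarrow> h \<in> I)"

definition answer_set :: "('r, 'f, 'v) program \<Rightarrow> ('r, 'f, 'v) asp_interp \<Rightarrow> bool" where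
  "answer_set \<Pi> I \<longleftrightarrow> is_model I (reduct \<Pi> I) \<and> (\<forall>J. J \<subset> I \<longrightarrow> \<not> is_model J (reduct \<Pi> I))"

datatype 'c arg = Var string | Const 'c

text \<open>Terms in hypotheses are ground: existential variables of the observation are
  represented by constants, and invented values by Skolem terms \<open>Skolem a j ts\<close>, where \<open>a\<close> identifies
  an axiom and \<open>j\<close> one of its variables.\<close>

datatype ('c, 'i) hterm = HConst 'c | Skolem 'i nat "('c, 'i) hterm list"

datatype ('p, 'c, 'i) horn =
  Horn (ident: 'i) (head: "('p, 'c arg) atom") (body: "('p, 'c arg) atom list")

text \<open>The variables in \<open>obs\<close> are the existentially quantified ones; \<open>exconst\<close> gives the constants
  that represent them.\<close>

record ('p, 'c, 'i) abduction =
  axioms :: "('p, 'c, 'i) horn set"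
  obs :: "('p, 'c arg) atom set"
  sorts :: "'c set"
  exconst :: "string \<Rightarrow> 'c"

definition atom_vars :: "('p, 'c arg) atom \<Rightarrow> string list" where
  "atom_vars a = [x. Var x \<leftarrow> args a]"

definition atom_consts :: "('p, 'c arg) atom \<Rightarrow> 'c set" where
  "atom_consts a = {c. Const c \<in> set (args a)}"

definition head_vars :: "('p, 'c, 'i) horn \<Rightarrow> string list" where
  "head_vars ax = atom_vars (head ax)"

definition body_vars :: "('p, 'c, 'i) horn \<Rightarrow> string list" where
  "body_vars ax = concat (map atom_vars (body ax))"

text \<open>An enumeration $Z_1,\dots,Z_v$ of the body variables that are not in the head.\<close>

definition exist_vars :: "('p, 'c, 'i) horn \<Rightarrow> string list" where
  "exist_vars ax = remdups (filter (\<lambda>x. x \<notin> set (head_vars ax)) (body_vars ax))"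

definition horn_consts :: "('p, 'c, 'i) horn \<Rightarrow> 'c set" where
  "horn_consts ax = (\<Union>a\<in>insert (head ax) (set (body ax)). atom_consts a)"

definition obs_vars :: "('p, 'c, 'i) abduction \<Rightarrow> string set" where
  "obs_vars A = (\<Union>a\<in>obs A. set (atom_vars a))"

primrec inst_arg :: "(string \<Rightarrow> ('c, 'i) hterm) \<Rightarrow> 'c arg \<Rightarrow> ('c, 'i) hterm" where
  "inst_arg \<theta> (Var x) = \<theta> x"
| "inst_arg \<theta> (Const c) = HConst c"

definition inst :: "(string \<Rightarrow> ('c, 'i) hterm) \<Rightarrow> ('p, 'c arg) atom \<Rightarrow> ('p, ('c, 'i) hterm) atom" where
  "inst \<theta> = map_atom id (inst_arg \<theta>)"

text \<open>Value invention: a variable \<open>Z\<^sub>j\<close> outside the head becomes the Skolem term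
  \<open>s(a, j, Y\<^sub>1, \<dots>, Y\<^sub>m)\<close> (with \<open>j\<close> counted from 1), instantiated by \<open>\<theta>\<close>.\<close>

definition skolemize ::
  "('p, 'c, 'i) horn \<Rightarrow> (string \<Rightarrow> ('c, 'i) hterm) \<Rightarrow> string \<Rightarrow> ('c, 'i) hterm" where
  "skolemize ax \<theta> x =
    (if x \<in> set (head_vars ax) then \<theta> x
     else Skolem (ident ax) (Suc (length (takeWhile (\<lambda>z. z \<noteq> x) (exist_vars ax))))
            (map \<theta> (head_vars ax)))"

definition body_inst ::
  "('p, 'c, 'i) horn \<Rightarrow> (string \<Rightarrow> ('c, 'i) hterm) \<Rightarrow> ('p, ('c, 'i) hterm) atom set" where
  "body_inst ax \<theta> = inst (skolemize ax \<theta>) ` set (body ax)"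

text \<open>There is an edge from an axiom to another one if back-chaining over the former can introduce
  an atom to which back-chaining over the latter applies. An axiom set is acyclic if no chain of
  such inferences returns to an axiom.\<close>

definition feeds :: "('p, 'c, 'i) horn set \<Rightarrow> ('p, 'c, 'i) horn rel" where
  "feeds B = {(R, R'). R \<in> B \<and> R' \<in> B \<and> (\<exists>\<theta> \<theta>'. inst \<theta>' (head R') \<in> body_inst R \<theta>)}"

definition abduction_instance :: "('p, 'c, 'i) abduction \<Rightarrow> bool" where
  "abduction_instance A \<longleftrightarrow>
    finite (axioms A) \<and>
    inj_on ident (axioms A) \<and>
    (\<forall>ax\<in>axioms A. set (head_vars ax) \<subseteq> set (body_vars ax)) \<and>
    acyclic (feeds (axioms A)) \<and>
    finite (obs A) \<and>
    sorts A \<subseteq> (\<Union>ax\<in>axioms A. horn_consts ax) \<and>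
    inj_on (exconst A) (obs_vars A) \<and>
    exconst A ` obs_vars A \<inter> sorts A = {}"

datatype ('p, 't) conjunct = At "('p, 't) atom" | Eq 't 't

type_synonym ('p, 'c, 'i) hypothesis = "('p, ('c, 'i) hterm) conjunct set"

definition goal_atoms :: "('p, 'c, 'i) abduction \<Rightarrow> ('p, ('c, 'i) hterm) atom set" where
  "goal_atoms A = inst (\<lambda>x. HConst (exconst A x)) ` obs A"

text \<open>Atoms of a hypothesis are ground, so \<open>\<theta>\<close> unifies such an atom with the head of an axiom iff
  it maps the head to the atom.\<close>

definition backchains ::
  "('p, 'c, 'i) abduction \<Rightarrow> ('p, 'c, 'i) hypothesis \<Rightarrow> ('p, ('c, 'i) hterm) atom
    \<Rightarrow> ('p, ('c, 'i) hterm) atom set \<Rightarrow> bool" where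
  "backchains A H P Ps \<longleftrightarrow>
    At P \<in> H \<and> (\<exists>ax\<in>axioms A. \<exists>\<theta>. inst \<theta> (head ax) = P \<and> Ps = body_inst ax \<theta>)"

text \<open>For the unification of two atoms of a hypothesis, constants and Skolem terms are existential
  values: a substitution replaces them as a whole and does not descend into Skolem terms.\<close>

definition unifier ::
  "(('c, 'i) hterm \<Rightarrow> ('c, 'i) hterm) \<Rightarrow> ('p, ('c, 'i) hterm) atom \<Rightarrow> ('p, ('c, 'i) hterm) atom
    \<Rightarrow> bool" where
  "unifier \<theta> P Q \<longleftrightarrow> map_atom id \<theta> P = map_atom id \<theta> Q"

text \<open>The quantified conjunct says that \<open>\<theta>\<close> is an idempotent most general unifier.\<close>

definition mgu ::
  "(('c, 'i) hterm \<Rightarrow> ('c, 'i) hterm) \<Rightarrow> ('p, ('c, 'i) hterm) atom \<Rightarrow> ('p, ('c, 'i) hterm) atom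
    \<Rightarrow> bool" where
  "mgu \<theta> P Q \<longleftrightarrow> unifier \<theta> P Q \<and> (\<forall>\<sigma>. unifier \<sigma> P Q \<longrightarrow> \<sigma> \<circ> \<theta> = \<sigma>)"

definition unifies ::
  "('p, 'c, 'i) abduction \<Rightarrow> ('p, 'c, 'i) hypothesis \<Rightarrow> ('p, ('c, 'i) hterm) atom
    \<Rightarrow> ('p, ('c, 'i) hterm) atom \<Rightarrow> ('p, 'c, 'i) hypothesis \<Rightarrow> bool" where
  "unifies A H P Q Es \<longleftrightarrow>
    At P \<in> H \<and> At Q \<in> H \<and> P \<noteq> Q \<and>
    (\<exists>\<theta>. mgu \<theta> P Q \<and>
         (\<forall>X. \<theta> X \<noteq> X \<longrightarrow> X \<notin> HConst ` sorts A \<and> \<theta> X \<notin> HConst ` sorts A) \<and>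
         Es = {Eq X (\<theta> X) | X. \<theta> X \<noteq> X})"

inductive_set hypotheses :: "('p, 'c, 'i) abduction \<Rightarrow> ('p, 'c, 'i) hypothesis set"
  for A :: "('p, 'c, 'i) abduction" where
  "At ` goal_atoms A \<in> hypotheses A"
| "\<lbrakk>H \<in> hypotheses A; backchains A H P Ps\<rbrakk> \<Longrightarrow> H \<union> At ` Ps \<in> hypotheses A"
| "\<lbrakk>H \<in> hypotheses A; unifies A H P Q Es\<rbrakk> \<Longrightarrow> H \<union> Es \<in> hypotheses A"

inductive_set backchaining_hypotheses :: "('p, 'c, 'i) abduction \<Rightarrow> ('p, 'c, 'i) hypothesis set"
  for A :: "('p, 'c, 'i) abduction" where
  "At ` goal_atoms A \<in> backchaining_hypotheses A"
| "\<lbrakk>H \<in> backchaining_hypotheses A; backchains A H P Ps\<rbrakk>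
    \<Longrightarrow> H \<union> At ` Ps \<in> backchaining_hypotheses A"

text \<open>\<open>generates A H E\<close>: some sequence of inference operations generates \<open>H\<close> and induces the
  edges \<open>E\<close>.\<close>

inductive generates ::
  "('p, 'c, 'i) abduction \<Rightarrow> ('p, 'c, 'i) hypothesis \<Rightarrow> ('p, ('c, 'i) hterm) atom rel \<Rightarrow> bool"
  for A :: "('p, 'c, 'i) abduction" where
  "generates A (At ` goal_atoms A) {}"
| "\<lbrakk>generates A H E; backchains A H P Ps\<rbrakk> \<Longrightarrow> generates A (H \<union> At ` Ps) (E \<union> Ps \<times> {P})"
| "\<lbrakk>generates A H E; unifies A H P Q Es\<rbrakk> \<Longrightarrow> generates A (H \<union> Es) (insert (P, Q) E)"
| "\<lbrakk>generates A H E; unifies A H P Q Es\<rbrakk> \<Longrightarrow> generates A (H \<union> Es) (insert (Q, P) E)"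

type_synonym ('p, 'c, 'i) graph =
  "('p, ('c, 'i) hterm) atom set \<times> ('p, ('c, 'i) hterm) atom rel"

definition proof_graph ::
  "('p, 'c, 'i) abduction \<Rightarrow> ('p, 'c, 'i) hypothesis \<Rightarrow> ('p, 'c, 'i) graph \<Rightarrow> bool" where
  "proof_graph A H G \<longleftrightarrow>
    H \<in> hypotheses A \<and> fst G = {P. At P \<in> H} \<and> generates A H (snd G) \<and> acyclic (snd G)"

definition backchaining_proof_graphs :: "('p, 'c, 'i) abduction \<Rightarrow> ('p, 'c, 'i) graph set" where
  "backchaining_proof_graphs A = {G. \<exists>H\<in>backchaining_hypotheses A. proof_graph A H G}"

datatype ('p, 'c, 'i) sym =
    CFun | SFun | LFun | PredName 'p | ConstName 'c | AxiomName 'i | Number nat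

datatype apred = Goal | Sortname | Pot | MayInferVia | InferenceNeeds

type_synonym ('p, 'c, 'i) aterm = "(('p, 'c, 'i) sym, string) asp_term"
type_synonym ('p, 'c, 'i) arule = "(apred, ('p, 'c, 'i) aterm) rule"

definition c_term :: "('p, ('p, 'c, 'i) aterm) atom \<Rightarrow> ('p, 'c, 'i) aterm" where
  "c_term a = AFun CFun (AFun (PredName (pred a)) [] # args a)"

definition s_term :: "'i \<Rightarrow> nat \<Rightarrow> ('p, 'c, 'i) aterm list \<Rightarrow> ('p, 'c, 'i) aterm" where
  "s_term a j ts = AFun SFun (AFun (AxiomName a) [] # AFun (Number j) [] # ts)"

definition l_term :: "('p, 'c, 'i) aterm list \<Rightarrow> ('p, 'c, 'i) aterm" where
  "l_term ts = AFun LFun ts"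

primrec enc_arg :: "'c arg \<Rightarrow> ('p, 'c, 'i) aterm" where
  "enc_arg (Var x) = AVar x"
| "enc_arg (Const c) = AFun (ConstName c) []"

primrec enc_hterm :: "('c, 'i) hterm \<Rightarrow> ('p, 'c, 'i) aterm" where
  "enc_hterm (HConst c) = AFun (ConstName c) []"
| "enc_hterm (Skolem a j ts) = s_term a j (map enc_hterm ts)"

definition schema_rep :: "('p, 'c arg) atom \<Rightarrow> ('p, 'c, 'i) aterm" where
  "schema_rep a = c_term (map_atom id enc_arg a)"

definition atom_rep :: "('p, ('c, 'i) hterm) atom \<Rightarrow> ('p, 'c, 'i) aterm" where
  "atom_rep P = c_term (map_atom id enc_hterm P)"

definition P_o :: "('p, 'c, 'i) abduction \<Rightarrow> ('p, 'c, 'i) arule set" where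
  "P_o A = {Rule (Atom Goal [atom_rep P]) [] | P. P \<in> goal_atoms A}"

definition P_s :: "('p, 'c, 'i) abduction \<Rightarrow> ('p, 'c, 'i) arule set" where
  "P_s A = {Rule (Atom Sortname [AFun (ConstName s) []]) [] | s. s \<in> sorts A}"

definition may_infer_atom :: "('p, 'c, 'i) horn \<Rightarrow> (apred, ('p, 'c, 'i) aterm) atom" where
  "may_infer_atom ax =
    Atom MayInferVia
      [AFun (AxiomName (ident ax)) [], schema_rep (head ax), l_term (map AVar (exist_vars ax))]"

definition may_infer_rule :: "('p, 'c, 'i) horn \<Rightarrow> ('p, 'c, 'i) arule" where
  "may_infer_rule ax =
    Rule (may_infer_atom ax)
      (Pos (Atom Pot [schema_rep (head ax)]) #
       [Equal (AVar z) (s_term (ident ax) j (map AVar (head_vars ax))).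
          (j, z) \<leftarrow> List.enumerate 1 (exist_vars ax)])"

definition needs_rule :: "('p, 'c, 'i) horn \<Rightarrow> ('p, 'c arg) atom \<Rightarrow> ('p, 'c, 'i) arule" where
  "needs_rule ax p =
    Rule (Atom InferenceNeeds
            [schema_rep (head ax), AFun (AxiomName (ident ax)) [], schema_rep p])
      [Pos (may_infer_atom ax)]"

definition P_b :: "('p, 'c, 'i) abduction \<Rightarrow> ('p, 'c, 'i) arule set" where
  "P_b A = (\<Union>ax\<in>axioms A. insert (may_infer_rule ax) (needs_rule ax ` set (body ax)))"

definition P_bos :: "('p, 'c, 'i) abduction \<Rightarrow> ('p, 'c, 'i) arule set" where
  "P_bos A = P_b A \<union> P_o A \<union> P_s A"

text \<open>The variables \<open>_1\<close> and \<open>_2\<close> stand for the two (distinct) anonymous variables.\<close>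

definition P_bpt :: "('p, 'c, 'i) abduction \<Rightarrow> ('p, 'c, 'i) arule set" where
  "P_bpt A = P_bos A \<union>
    {Rule (Atom Pot [AVar ''X'']) [Pos (Atom Goal [AVar ''X''])],
     Rule (Atom Pot [AVar ''P''])
       [Pos (Atom InferenceNeeds [AVar ''_1'', AVar ''_2'', AVar ''P''])]}"

end

theory Submission
  imports Defs
begin

text \<open>The program is free of negation, so its only answer set is its least model, and it suffices to
  guess that model. Let \<open>N\<close> be the least set of atoms that contains the observation and is closed under
  back-chaining. The least model consists of the facts, of \<open>pot\<close> on the encodings of \<open>N\<close>, and of one
  instance of the two axiom rules for each back-chaining step from an atom of \<open>N\<close>: a match of the rule head
  with an encoded atom determines the head variables, and the equalities in the rule then force the
  remaining ones to be the Skolem terms of value invention. A unification always adds an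
  equality, so hypotheses generated by back-chaining have proof graphs made of back-chaining edges only; such graphs are acyclic because a cycle would be a cycle of \<open>feeds\<close>.\<close>

section \<open>Answer sets of programs without negation\<close>

text \<open>Ground instances are expressed through substitutions, and a built-in equality becomes a
  condition on the substitution. The notion is meant for programs without negation.\<close>

definition rule_closed :: "('r, 'f, 'v) program \<Rightarrow> ('r, 'f, 'v) asp_interp \<Rightarrow> bool" where
  "rule_closed \<Pi> J \<longleftrightarrow>
    (\<forall>r\<in>\<Pi>. \<forall>\<sigma>. (\<forall>x\<in>rule_vars r. \<sigma> x \<in> herbrand_universe \<Pi>) \<longrightarrow>
      (\<forall>s t. Equal s t \<in> set (rule_body r) \<longrightarrow> asp_subst \<sigma> s = asp_subst \<sigma> t) \<longrightarrow>
      (\<forall>a. Pos a \<in> set (rule_body r) \<longrightarrow> map_atom id (asp_subst \<sigma>) a \<in> J) \<longrightarrow>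
      map_atom id (asp_subst \<sigma>) (rule_head r) \<in> J)"

lemma in_map_literal_image:
  "Pos a \<in> map_literal f g ` L \<longleftrightarrow> (\<exists>b. Pos b \<in> L \<and> a = map_atom f g b)"
  "Naf a \<in> map_literal f g ` L \<longleftrightarrow> (\<exists>b. Naf b \<in> L \<and> a = map_atom f g b)"
  "Equal s t \<in> map_literal f g ` L \<longleftrightarrow> (\<exists>s' t'. Equal s' t' \<in> L \<and> s = g s' \<and> t = g t')"
proof -
  have "Pos a = map_literal f g l \<longleftrightarrow> (\<exists>b. l = Pos b \<and> a = map_atom f g b)"
    "Naf a = map_literal f g l \<longleftrightarrow> (\<exists>b. l = Naf b \<and> a = map_atom f g b)"
    "Equal s t = map_literal f g l \<longleftrightarrow> (\<exists>s' t'. l = Equal s' t' \<and> s = g s' \<and> t = g t')" for l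
    by (cases l; simp)+
  note * = this
  show "Pos a \<in> map_literal f g ` L \<longleftrightarrow> (\<exists>b. Pos b \<in> L \<and> a = map_atom f g b)"
    "Naf a \<in> map_literal f g ` L \<longleftrightarrow> (\<exists>b. Naf b \<in> L \<and> a = map_atom f g b)"
    "Equal s t \<in> map_literal f g ` L \<longleftrightarrow> (\<exists>s' t'. Equal s' t' \<in> L \<and> s = g s' \<and> t = g t')"
    by (auto simp: image_iff *)
qed

text \<open>Without negative literals \<open>I\<close> removes no rule, so the reduct is the same
  for all interpretations. Heads and bodies commute with substitution, which turns ground rules back
  into instances of rules of \<open>\<Pi>\<close>.\<close>

lemma is_model_reduct_iff:
  fixes \<Pi> :: "('r, 'f, 'v) program"
  assumes no_naf: "\<And>r a. r \<in> \<Pi> \<Longrightarrow> Naf a \<notin> set (rule_body r)"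
  shows "is_model J (reduct \<Pi> I) \<longleftrightarrow> rule_closed \<Pi> J"
proof -
  have body: "set (rule_body (map_rule id (asp_subst \<sigma>) r)) =
      map_literal id (asp_subst \<sigma>) ` set (rule_body r)"
    for r :: "('r, ('f, 'v) asp_term) rule" and \<sigma> :: "'v \<Rightarrow> ('f, 'v) asp_term"
    by (simp add: rule.map_sel)
  have pos: "{a. Pos a \<in> set (rule_body (map_rule id (asp_subst \<sigma>) r))} \<subseteq> J \<longleftrightarrow>
      (\<forall>a. Pos a \<in> set (rule_body r) \<longrightarrow> map_atom id (asp_subst \<sigma>) a \<in> J)"
    for r :: "('r, ('f, 'v) asp_term) rule" and \<sigma> :: "'v \<Rightarrow> ('f, 'v) asp_term"
    unfolding body in_map_literal_image by auto
  have equal: "(\<forall>s t. Equal s t \<in> set (rule_body (map_rule id (asp_subst \<sigma>) r)) \<longrightarrow> s = t) \<longleftrightarrow>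
      (\<forall>s t. Equal s t \<in> set (rule_body r) \<longrightarrow> asp_subst \<sigma> s = asp_subst \<sigma> t)"
    for r :: "('r, ('f, 'v) asp_term) rule" and \<sigma> :: "'v \<Rightarrow> ('f, 'v) asp_term"
    unfolding body in_map_literal_image by metis
  have naf: "Naf a \<notin> set (rule_body r)" if "r \<in> grounding \<Pi>" for a r
    using that no_naf unfolding grounding_def by (auto simp: rule.map_sel in_map_literal_image)
  have "reduct \<Pi> I = (\<lambda>r. (rule_head r, {a. Pos a \<in> set (rule_body r)})) `
      {r \<in> grounding \<Pi>. \<forall>s t. Equal s t \<in> set (rule_body r) \<longrightarrow> s = t}"
    unfolding reduct_def image_Collect using naf by (intro Collect_cong) metis
  then have "is_model J (reduct \<Pi> I) \<longleftrightarrow> (\<forall>r\<in>grounding \<Pi>.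
      (\<forall>s t. Equal s t \<in> set (rule_body r) \<longrightarrow> s = t) \<longrightarrow>
      {a. Pos a \<in> set (rule_body r)} \<subseteq> J \<longrightarrow> rule_head r \<in> J)"
    unfolding is_model_def by simp (simp add: Ball_def imp_conjL)
  moreover have "(\<forall>r\<in>grounding \<Pi>. Q r) \<longleftrightarrow>
      (\<forall>r\<in>\<Pi>. \<forall>\<sigma>. (\<forall>x\<in>rule_vars r. \<sigma> x \<in> herbrand_universe \<Pi>) \<longrightarrow>
        Q (map_rule id (asp_subst \<sigma>) r))" for Q
    unfolding grounding_def by blast
  ultimately show ?thesis
    by (simp only: pos equal rule.map_sel(1) rule_closed_def)
qed

text \<open>As the reduct does not depend on the interpretation, answer sets are the minimal closed
  interpretations, and a least one is the only minimal one.\<close>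

lemma answer_set_iff_least_closed:
  assumes "\<And>r a. r \<in> \<Pi> \<Longrightarrow> Naf a \<notin> set (rule_body r)"
    and "rule_closed \<Pi> I"
    and "\<And>J. rule_closed \<Pi> J \<Longrightarrow> I \<subseteq> J"
  shows "answer_set \<Pi> J \<longleftrightarrow> J = I"
proof -
  have "is_model K (reduct \<Pi> J) \<longleftrightarrow> rule_closed \<Pi> K" for K
    by (rule is_model_reduct_iff) (fact assms(1))
  then have "answer_set \<Pi> J \<longleftrightarrow> rule_closed \<Pi> J \<and> (\<forall>K. K \<subset> J \<longrightarrow> \<not> rule_closed \<Pi> K)"
    unfolding answer_set_def by (simp only:)
  moreover have "\<dots> \<longleftrightarrow> J = I"
    by (metis assms(2,3) psubsetI leD)
  ultimately show ?thesis
    by (simp only:)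
qed

lemma rule_closedD:
  assumes "rule_closed \<Pi> J" "Rule h b \<in> \<Pi>"
    and "\<And>x. x \<in> rule_vars (Rule h b) \<Longrightarrow> \<sigma> x \<in> herbrand_universe \<Pi>"
    and "\<And>s t. Equal s t \<in> set b \<Longrightarrow> asp_subst \<sigma> s = asp_subst \<sigma> t"
    and "\<And>a. Pos a \<in> set b \<Longrightarrow> map_atom id (asp_subst \<sigma>) a \<in> J"
  shows "map_atom id (asp_subst \<sigma>) h \<in> J"
  using assms(1)[unfolded rule_closed_def, rule_format, OF assms(2), of \<sigma>] assms(3-) by simp

section \<open>Terms of the Herbrand universe\<close>

lemma herbrand_universe_args:
  "AFun f ts \<in> herbrand_universe \<Pi> \<Longrightarrow> t \<in> set ts \<Longrightarrow> t \<in> herbrand_universe \<Pi>"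
  by (cases rule: herbrand_universe.cases) auto

lemma asp_subst_in_herbrand_universe:
  assumes "asp_syms t \<subseteq> signature \<Pi>" "\<And>x. x \<in> asp_vars t \<Longrightarrow> \<sigma> x \<in> herbrand_universe \<Pi>"
  shows "asp_subst \<sigma> t \<in> herbrand_universe \<Pi>"
  using assms
proof (induction t)
  case (AFun f ts)
  have "asp_subst \<sigma> t \<in> herbrand_universe \<Pi>" if "t \<in> set ts" for t
    using AFun that by (simp add: UN_subset_iff) blast
  then show ?case
    using AFun.prems(1) by (auto intro!: herbrand_universe.intros)
qed simp

text \<open>All symbols of a term that occurs in the program belong to the signature. This is how
  ground terms are shown to be available for grounding.\<close>

lemma rule_term_in_herbrand_universe:
  assumes "r \<in> \<Pi>" "t \<in> rule_terms r" "\<And>x. x \<in> asp_vars t \<Longrightarrow> \<sigma> x \<in> herbrand_universe \<Pi>"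
  shows "asp_subst \<sigma> t \<in> herbrand_universe \<Pi>"
proof (rule asp_subst_in_herbrand_universe)
  show "asp_syms t \<subseteq> signature \<Pi>"
    using assms(1,2) unfolding signature_def program_syms_def by auto
qed (fact assms(3))

section \<open>Encoding of terms and atoms\<close>

lemma enc_hterm_eq_const_iff: "AFun (ConstName c) [] = enc_hterm t \<longleftrightarrow> t = HConst c"
  by (cases t) (auto simp: s_term_def)

text \<open>An \<open>s_term\<close> keeps the identifier, the index and the arguments, and its
  function symbol differs from that of every constant; hence terms can be decoded.\<close>

lemma inj_enc_hterm: "inj (enc_hterm :: ('c, 'i) hterm \<Rightarrow> ('p, 'c, 'i) aterm)"
proof (rule injI)
  fix t u :: "('c, 'i) hterm"
  show "(enc_hterm t :: ('p, 'c, 'i) aterm) = enc_hterm u \<Longrightarrow> t = u"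
  proof (induction t arbitrary: u)
    case (HConst c)
    then show ?case by (simp add: enc_hterm_eq_const_iff)
  next
    case (Skolem i j ts)
    obtain us where u: "u = Skolem i j us" "map (enc_hterm :: _ \<Rightarrow> ('p, 'c, 'i) aterm) ts = map enc_hterm us"
      using Skolem.prems by (cases u) (auto simp: s_term_def)
    have "ts = us"
      using Skolem.IH u(2) by (rule list.inj_map_strong)
    then show ?case
      using u(1) by simp
  qed
qed

lemma asp_subst_enc_hterm: "asp_subst \<sigma> (enc_hterm t) = enc_hterm t"
  by (induction t) (auto simp: s_term_def)

lemma asp_vars_enc_hterm: "asp_vars (enc_hterm t) = {}"
  by (induction t) (auto simp: s_term_def)

lemma asp_subst_atom_rep: "asp_subst \<sigma> (atom_rep P) = atom_rep P"
  by (cases P) (simp add: atom_rep_def c_term_def asp_subst_enc_hterm)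

lemma asp_vars_atom_rep: "asp_vars (atom_rep P) = {}"
  by (cases P) (simp add: atom_rep_def c_term_def asp_vars_enc_hterm)

lemma in_atom_vars_iff: "x \<in> set (atom_vars a) \<longleftrightarrow> Var x \<in> set (args a)"
proof -
  have "set (case y of Var x \<Rightarrow> [x] | Const c \<Rightarrow> []) = {x. y = Var x}" for y :: "'b arg"
    by (cases y) auto
  then show ?thesis
    by (auto simp: atom_vars_def)
qed

lemma asp_vars_enc_arg: "x \<in> asp_vars (enc_arg y) \<longleftrightarrow> y = Var x"
  by (cases y) auto

lemma asp_vars_schema_rep: "asp_vars (schema_rep a) = set (atom_vars a)"
  by (cases a) (auto simp: schema_rep_def c_term_def in_atom_vars_iff asp_vars_enc_arg)

lemma asp_subst_enc_arg_eq_iff: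
  "asp_subst \<sigma> (enc_arg y) = enc_hterm (inst_arg \<theta> y) \<longleftrightarrow>
    (\<forall>x. y = Var x \<longrightarrow> \<sigma> x = enc_hterm (\<theta> x))"
  by (cases y) auto

text \<open>Relates program substitutions to instantiations of axioms: both leave constants alone,
  so only the variable positions contribute conditions.\<close>

lemma asp_subst_schema_rep_eq_iff:
  "asp_subst \<sigma> (schema_rep a) = atom_rep (inst \<theta> a) \<longleftrightarrow>
    (\<forall>x\<in>set (atom_vars a). \<sigma> x = enc_hterm (\<theta> x))"
  by (cases a)
    (auto simp: schema_rep_def atom_rep_def inst_def c_term_def in_atom_vars_iff
      asp_subst_enc_arg_eq_iff)

text \<open>A program substitution may send a variable to a term that encodes no hypothesis term,
  such as a \<open>c_term\<close>. For the variables of \<open>a\<close> the match rules this out: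
  each stands at an argument position and faces an encoded term there.\<close>

lemma asp_subst_schema_rep_eq_atom_repD:
  assumes "asp_subst \<sigma> (schema_rep a) = atom_rep P"
  shows "\<exists>\<theta>. P = inst \<theta> a \<and> (\<forall>x\<in>set (atom_vars a). \<sigma> x = enc_hterm (\<theta> x))"
proof -
  obtain p ys where a: "a = Atom p ys" by (cases a)
  obtain q ts where P: "P = Atom q ts" by (cases P)
  have eq: "p = q" "map (\<lambda>y. asp_subst \<sigma> (enc_arg y)) ys = map enc_hterm ts"
    using assms by (simp_all add: a P schema_rep_def atom_rep_def c_term_def comp_def)
  \<comment> \<open>This decodes by the inverse of \<open>enc_hterm\<close>; it is meaningful at the
    variables of \<open>a\<close>, where the values turn out to be encodings.\<close>
  define \<theta> where "\<theta> x = inv enc_hterm (\<sigma> x)" for x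
  have len: "length ys = length ts"
    using eq(2) by (rule map_eq_imp_length_eq)
  have nth: "ts ! i = inst_arg \<theta> (ys ! i)" if "i < length ys" for i
  proof -
    have i: "asp_subst \<sigma> (enc_arg (ys ! i)) = enc_hterm (ts ! i)"
      using arg_cong[OF eq(2), of "\<lambda>l. l ! i"] that len by simp
    show ?thesis
    proof (cases "ys ! i")
      case (Var x)
      then show ?thesis
        using i by (simp add: \<theta>_def inv_f_f[OF inj_enc_hterm])
    next
      case (Const c)
      then show ?thesis
        using i by (simp add: enc_hterm_eq_const_iff)
    qed
  qed
  then have "P = inst \<theta> a"
    using len eq(1) by (simp add: a P inst_def list_eq_iff_nth_eq)
  then show ?thesis
    using assms asp_subst_schema_rep_eq_iff by metis
qed

section \<open>Value invention\<close>

lemma distinct_exist_vars: "distinct (exist_vars ax)"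
  by (simp add: exist_vars_def)

lemma set_exist_vars: "set (exist_vars ax) = set (body_vars ax) - set (head_vars ax)"
  by (auto simp: exist_vars_def)

lemma set_body_vars: "set (body_vars ax) = (\<Union>p\<in>set (body ax). set (atom_vars p))"
  by (simp add: body_vars_def)

text \<open>Reconciles two descriptions of a position: \<open>skolemize\<close> counts with
  \<open>takeWhile\<close>, the rule for \<open>mayInferVia\<close> with
  \<open>List.enumerate\<close>. Distinctness makes the position unique.\<close>

lemma in_enumerate_iff_takeWhile:
  assumes "distinct xs"
  shows "(j, z) \<in> set (List.enumerate n xs) \<longleftrightarrow>
    z \<in> set xs \<and> j = n + length (takeWhile (\<lambda>y. y \<noteq> z) xs)"
  using assms
proof (induction xs arbitrary: n)
  case (Cons x xs)
  show ?case
  proof (cases "x = z")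
    case True
    then have "(j, z) \<notin> set (List.enumerate (Suc n) xs)"
      using Cons by simp
    then show ?thesis
      using True by auto
  next
    case False
    then show ?thesis
      using Cons by auto
  qed
qed simp

lemma skolemize_head_var: "x \<in> set (head_vars ax) \<Longrightarrow> skolemize ax \<theta> x = \<theta> x"
  by (simp add: skolemize_def)

text \<open>The start value 1 of the enumeration matches the \<open>Suc\<close> in
  \<open>skolemize\<close>, so \<open>j\<close> is the index that the equality in the rule writes
  into the Skolem term.\<close>

lemma skolemize_exist_var:
  assumes "(j, z) \<in> set (List.enumerate 1 (exist_vars ax))"
  shows "skolemize ax \<theta> z = Skolem (ident ax) j (map \<theta> (head_vars ax))"
  using assms
  by (auto simp: skolemize_def in_enumerate_iff_takeWhile[OF distinct_exist_vars] set_exist_vars)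

section \<open>Back-chaining from the observation\<close>

text \<open>The set called \<open>N\<close> above.\<close>

inductive_set potential :: "('p, 'c, 'i) abduction \<Rightarrow> ('p, ('c, 'i) hterm) atom set"
  for A :: "('p, 'c, 'i) abduction" where
  goal: "P \<in> goal_atoms A \<Longrightarrow> P \<in> potential A"
| backchain: "\<lbrakk>ax \<in> axioms A; inst \<theta> (head ax) \<in> potential A; Q \<in> body_inst ax \<theta>\<rbrakk>
    \<Longrightarrow> Q \<in> potential A"

definition potential_edges :: "('p, 'c, 'i) abduction \<Rightarrow> ('p, ('c, 'i) hterm) atom rel" where
  "potential_edges A = {(Q, inst \<theta> (head ax)) | Q ax \<theta>.
    ax \<in> axioms A \<and> inst \<theta> (head ax) \<in> potential A \<and> Q \<in> body_inst ax \<theta>}"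

text \<open>The identity does not unify distinct atoms, so the unifier moves some term. Equalities
  thus witness the use of unification.\<close>

lemma unifies_adds_equality:
  assumes "unifies A H P Q Es"
  shows "\<exists>X Y. Eq X Y \<in> Es"
proof -
  obtain \<theta> where \<theta>: "mgu \<theta> P Q" "Es = {Eq X (\<theta> X) | X. \<theta> X \<noteq> X}" and "P \<noteq> Q"
    using assms unfolding unifies_def by blast
  have "\<exists>X. \<theta> X \<noteq> X"
  proof (rule ccontr)
    assume "\<nexists>X. \<theta> X \<noteq> X"
    then have "\<theta> = id" by auto
    then show False
      using \<theta>(1) \<open>P \<noteq> Q\<close> by (simp add: mgu_def unifier_def atom.map_id)
  qed
  then show ?thesis
    using \<theta>(2) by blast
qed

lemma backchains_potential:
  assumes "backchains A H P Ps" "{P. At P \<in> H} \<subseteq> potential A"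
  shows "Ps \<subseteq> potential A" "Ps \<times> {P} \<subseteq> potential_edges A"
  using assms unfolding backchains_def potential_edges_def
  by (blast intro: potential.backchain)+

text \<open>A hypothesis may be generated in several ways, so the kind of its edges has to follow
  from \<open>H\<close> alone: equalities are never removed, hence an \<open>H\<close> without them
  excludes unification from every generation.\<close>

lemma generates_potential:
  assumes "generates A H E"
  shows "{P. At P \<in> H} \<subseteq> potential A \<and> ((\<forall>X Y. Eq X Y \<notin> H) \<longrightarrow> E \<subseteq> potential_edges A)"
  using assms
proof induction
  case 1
  show ?case by (auto intro: potential.goal)
next
  case (2 H E P Ps)
  then show ?case
    using backchains_potential[OF 2(2)] by auto
next
  \<comment> \<open>\<open>Es\<close> is nonempty and consists of equalities: no atom is added, and
    the condition of the edge claim fails.\<close>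
  case (3 H E P Q Es)
  then show ?case
    using unifies_adds_equality[OF 3(2)] by (auto simp: unifies_def)
next
  case (4 H E P Q Es)
  then show ?case
    using unifies_adds_equality[OF 4(2)] by (auto simp: unifies_def)
qed

lemma backchaining_hypotheses_no_equality:
  "H \<in> backchaining_hypotheses A \<Longrightarrow> Eq X Y \<notin> H"
  by (induction rule: backchaining_hypotheses.induct) auto

lemma backchaining_hypotheses_subset: "backchaining_hypotheses A \<subseteq> hypotheses A"
proof
  fix H assume "H \<in> backchaining_hypotheses A"
  then show "H \<in> hypotheses A"
    by induction (auto intro: hypotheses.intros)
qed

text \<open>Each step of \<open>potential\<close> has one atom as premise, so a single hypothesis
  grows along the derivation and none have to be merged. \<open>generates\<close> is carried along
  to provide the edges of a proof graph.\<close>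

lemma potential_in_backchaining_hypothesis:
  assumes "P \<in> potential A"
  shows "\<exists>H E. H \<in> backchaining_hypotheses A \<and> generates A H E \<and> At P \<in> H"
  using assms
proof induction
  case (goal P)
  then show ?case
    by (blast intro: backchaining_hypotheses.intros generates.intros)
next
  case (backchain ax \<theta> Q)
  then obtain H E where H: "H \<in> backchaining_hypotheses A" "generates A H E"
    "At (inst \<theta> (head ax)) \<in> H" by blast
  then have "backchains A H (inst \<theta> (head ax)) (body_inst ax \<theta>)"
    using backchain unfolding backchains_def by blast
  then show ?case
    using H backchain by (blast intro: backchaining_hypotheses.intros generates.intros)
qed

text \<open>Paths are projected to axioms with the direction reversed: edges run from body atoms to
  heads, \<open>feeds\<close> from an axiom to one applied after it. \<open>R\<close> introduces the
  start \<open>x\<close>, and \<open>R'\<close> explains the end \<open>y\<close>; for a single edge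
  they coincide, whence the reflexive closure.\<close>

lemma potential_edges_trancl:
  assumes "(x, y) \<in> (potential_edges A)\<^sup>+"
  shows "\<exists>R\<in>axioms A. \<exists>R'\<in>axioms A. \<exists>\<theta> \<theta>'. x \<in> body_inst R \<theta> \<and> y = inst \<theta>' (head R') \<and>
    (R', R) \<in> (feeds (axioms A))\<^sup>*"
  using assms
proof induction
  case (base y)
  then show ?case
    unfolding potential_edges_def by blast
next
  case (step y z)
  then obtain R R' \<theta> \<theta>' where R: "R \<in> axioms A" "R' \<in> axioms A" "x \<in> body_inst R \<theta>"
    "y = inst \<theta>' (head R')" "(R', R) \<in> (feeds (axioms A))\<^sup>*" by blast
  obtain S \<phi> where S: "S \<in> axioms A" "y \<in> body_inst S \<phi>" "z = inst \<phi> (head S)"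
    using step(2) unfolding potential_edges_def by blast
  have "(S, R') \<in> feeds (axioms A)"
    using R S unfolding feeds_def by blast
  then have "(S, R) \<in> (feeds (axioms A))\<^sup>*"
    using R(5) by (rule converse_rtrancl_into_rtrancl)
  then show ?case
    using R S by blast
qed

lemma acyclic_potential_edges:
  assumes "acyclic (feeds (axioms A))"
  shows "acyclic (potential_edges A)"
proof (rule acyclicI, intro allI notI)
  fix x assume "(x, x) \<in> (potential_edges A)\<^sup>+"
  then obtain R R' \<theta> \<theta>' where R: "R \<in> axioms A" "R' \<in> axioms A" "x \<in> body_inst R \<theta>"
    "x = inst \<theta>' (head R')" "(R', R) \<in> (feeds (axioms A))\<^sup>*"
    using potential_edges_trancl by blast
  \<comment> \<open>\<open>R\<close> introduces \<open>x\<close> and \<open>R'\<close> applies to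
    it, which closes the chain from \<open>R'\<close> to \<open>R\<close> into a cycle.\<close>
  then have "(R, R') \<in> feeds (axioms A)"
    unfolding feeds_def by blast
  then have "(R, R) \<in> (feeds (axioms A))\<^sup>+"
    using R(5) by (rule rtrancl_into_trancl2)
  then show False
    using assms unfolding acyclic_def by blast
qed

section \<open>The union of the proof graphs\<close>

lemma backchaining_proof_graph_potential:
  assumes "G \<in> backchaining_proof_graphs A"
  shows "fst G \<subseteq> potential A" "snd G \<subseteq> potential_edges A"
proof -
  obtain H where "H \<in> backchaining_hypotheses A" "generates A H (snd G)" "fst G = {P. At P \<in> H}"
    using assms unfolding backchaining_proof_graphs_def proof_graph_def by blast
  then show "fst G \<subseteq> potential A" "snd G \<subseteq> potential_edges A"
    using generates_potential[of A H "snd G"] backchaining_hypotheses_no_equality by blast+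
qed

text \<open>Acyclicity of \<open>E\<close> is inherited from the larger relation
  \<open>potential_edges A\<close>.\<close>

lemma generates_in_backchaining_proof_graphs:
  assumes "acyclic (feeds (axioms A))" "H \<in> backchaining_hypotheses A" "generates A H E"
  shows "({P. At P \<in> H}, E) \<in> backchaining_proof_graphs A"
proof -
  have "E \<subseteq> potential_edges A"
    using generates_potential[OF assms(3)] backchaining_hypotheses_no_equality[OF assms(2)] by blast
  then have "acyclic E"
    using acyclic_potential_edges[OF assms(1)] acyclic_subset by blast
  then show ?thesis
    using assms(2,3) backchaining_hypotheses_subset
    unfolding backchaining_proof_graphs_def proof_graph_def by auto
qed

lemma backchaining_proof_graphs_nodes:
  assumes "acyclic (feeds (axioms A))"
  shows "(\<Union>G\<in>backchaining_proof_graphs A. fst G) = potential A"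
proof
  show "potential A \<subseteq> (\<Union>G\<in>backchaining_proof_graphs A. fst G)"
  proof
    fix P assume "P \<in> potential A"
    then obtain H E where "H \<in> backchaining_hypotheses A" "generates A H E" "At P \<in> H"
      using potential_in_backchaining_hypothesis by blast
    then show "P \<in> (\<Union>G\<in>backchaining_proof_graphs A. fst G)"
      by (intro UN_I[OF generates_in_backchaining_proof_graphs[OF assms]]) simp_all
  qed
qed (use backchaining_proof_graph_potential in blast)

lemma backchaining_proof_graphs_edges:
  assumes "acyclic (feeds (axioms A))"
  shows "(\<Union>G\<in>backchaining_proof_graphs A. snd G) = potential_edges A"
proof
  show "potential_edges A \<subseteq> (\<Union>G\<in>backchaining_proof_graphs A. snd G)"
  proof
    fix e assume "e \<in> potential_edges A"
    then obtain Q ax \<theta> where e: "e = (Q, inst \<theta> (head ax))" "ax \<in> axioms A"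
      "inst \<theta> (head ax) \<in> potential A" "Q \<in> body_inst ax \<theta>"
      unfolding potential_edges_def by blast
    obtain H E where H: "H \<in> backchaining_hypotheses A" "generates A H E"
      "At (inst \<theta> (head ax)) \<in> H"
      using potential_in_backchaining_hypothesis[OF e(3)] by blast
    \<comment> \<open>A hypothesis that contains the target of the edge is back-chained once more
      over \<open>ax\<close>; this step induces the edge, whether or not its body atoms are
      new.\<close>
    then have bc: "backchains A H (inst \<theta> (head ax)) (body_inst ax \<theta>)"
      using e(2) unfolding backchains_def by blast
    show "e \<in> (\<Union>G\<in>backchaining_proof_graphs A. snd G)"
      using generates_in_backchaining_proof_graphs[OF assms
          backchaining_hypotheses.intros(2)[OF H(1) bc] generates.intros(2)[OF H(2) bc]]
      by (rule UN_I) (simp add: e(1,4))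
  qed
qed (use backchaining_proof_graph_potential in blast)

section \<open>The least model of the rewriting\<close>

definition potential_inferences ::
  "('p, 'c, 'i) abduction \<Rightarrow> (('p, 'c, 'i) horn \<times> (string \<Rightarrow> ('c, 'i) hterm)) set" where
  "potential_inferences A = {(ax, \<theta>). ax \<in> axioms A \<and> inst \<theta> (head ax) \<in> potential A}"

definition may_infer_inst ::
  "('p, 'c, 'i) horn \<Rightarrow> (string \<Rightarrow> ('c, 'i) hterm) \<Rightarrow> (apred, ('p, 'c, 'i) aterm) atom" where
  "may_infer_inst ax \<theta> = Atom MayInferVia [AFun (AxiomName (ident ax)) [],
    atom_rep (inst \<theta> (head ax)), l_term (map (\<lambda>z. enc_hterm (skolemize ax \<theta> z)) (exist_vars ax))]"

definition needs_inst ::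
  "('p, 'c, 'i) horn \<Rightarrow> (string \<Rightarrow> ('c, 'i) hterm) \<Rightarrow> ('p, ('c, 'i) hterm) atom
    \<Rightarrow> (apred, ('p, 'c, 'i) aterm) atom" where
  "needs_inst ax \<theta> Q = Atom InferenceNeeds
    [atom_rep (inst \<theta> (head ax)), AFun (AxiomName (ident ax)) [], atom_rep Q]"

definition rewriting_model ::
  "('p, 'c, 'i) abduction \<Rightarrow> (apred, ('p, 'c, 'i) sym, string) asp_interp" where
  "rewriting_model A =
    (\<lambda>P. Atom Goal [atom_rep P]) ` goal_atoms A \<union>
    (\<lambda>s. Atom Sortname [AFun (ConstName s) []]) ` sorts A \<union>
    (\<lambda>P. Atom Pot [atom_rep P]) ` potential A \<union>
    (\<lambda>(ax, \<theta>). may_infer_inst ax \<theta>) ` potential_inferences A \<union>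
    (\<Union>(ax, \<theta>)\<in>potential_inferences A. needs_inst ax \<theta> ` body_inst ax \<theta>)"

lemma in_rewriting_model:
  "Atom Goal ts \<in> rewriting_model A \<longleftrightarrow> (\<exists>P\<in>goal_atoms A. ts = [atom_rep P])"
  "Atom Sortname ts \<in> rewriting_model A \<longleftrightarrow> (\<exists>s\<in>sorts A. ts = [AFun (ConstName s) []])"
  "Atom Pot ts \<in> rewriting_model A \<longleftrightarrow> (\<exists>P\<in>potential A. ts = [atom_rep P])"
  "Atom MayInferVia ts \<in> rewriting_model A \<longleftrightarrow>
    (\<exists>ax \<theta>. (ax, \<theta>) \<in> potential_inferences A \<and> Atom MayInferVia ts = may_infer_inst ax \<theta>)"
  "Atom InferenceNeeds ts \<in> rewriting_model A \<longleftrightarrow>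
    (\<exists>ax \<theta> Q. (ax, \<theta>) \<in> potential_inferences A \<and> Q \<in> body_inst ax \<theta> \<and>
      Atom InferenceNeeds ts = needs_inst ax \<theta> Q)"
  by (auto simp: rewriting_model_def may_infer_inst_def needs_inst_def image_iff Bex_def)

lemma inference_in_rewriting_model:
  assumes "(ax, \<theta>) \<in> potential_inferences A"
  shows "may_infer_inst ax \<theta> \<in> rewriting_model A"
    and "Q \<in> body_inst ax \<theta> \<Longrightarrow> needs_inst ax \<theta> Q \<in> rewriting_model A"
  using assms unfolding rewriting_model_def by force+

text \<open>\<open>skolemize ax \<theta>\<close> describes all variables of the rule at once: it is
  \<open>\<theta>\<close> on head variables and gives the invented terms elsewhere.\<close>

lemma asp_subst_may_infer_atom:
  assumes "\<And>x. x \<in> set (head_vars ax) \<union> set (exist_vars ax) \<Longrightarrow> \<sigma> x = enc_hterm (skolemize ax \<theta> x)"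
  shows "map_atom id (asp_subst \<sigma>) (may_infer_atom ax) = may_infer_inst ax \<theta>"
proof -
  have "asp_subst \<sigma> (schema_rep (head ax)) = atom_rep (inst \<theta> (head ax))"
    using assms unfolding asp_subst_schema_rep_eq_iff head_vars_def[symmetric]
    by (simp add: skolemize_head_var)
  then show ?thesis
    using assms by (simp add: may_infer_atom_def may_infer_inst_def l_term_def)
qed

text \<open>Every variable of a body atom is a head variable or listed in
  \<open>exist_vars ax\<close>, so the condition on \<open>\<sigma>\<close> covers it.\<close>

lemma asp_subst_body_atom:
  assumes "\<And>x. x \<in> set (head_vars ax) \<union> set (exist_vars ax) \<Longrightarrow> \<sigma> x = enc_hterm (skolemize ax \<theta> x)"
    and "p \<in> set (body ax)"
  shows "asp_subst \<sigma> (schema_rep p) = atom_rep (inst (skolemize ax \<theta>) p)"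
  using assms unfolding asp_subst_schema_rep_eq_iff set_exist_vars set_body_vars by blast

text \<open>The head variables are read off the encoded head, the remaining ones off the
  \<open>l_term\<close>, which lists all their values.\<close>

lemma may_infer_match:
  assumes "map_atom id (asp_subst \<sigma>) (may_infer_atom ax) = may_infer_inst ax \<theta>"
    and "x \<in> set (head_vars ax) \<union> set (exist_vars ax)"
  shows "\<sigma> x = enc_hterm (skolemize ax \<theta> x)"
proof -
  have "asp_subst \<sigma> (schema_rep (head ax)) = atom_rep (inst \<theta> (head ax))"
    "\<forall>z\<in>set (exist_vars ax). \<sigma> z = enc_hterm (skolemize ax \<theta> z)"
    using assms(1) by (simp_all add: may_infer_atom_def may_infer_inst_def l_term_def)
  then show ?thesis
    using assms(2) unfolding asp_subst_schema_rep_eq_iff head_vars_def[symmetric]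
    by (auto simp: skolemize_head_var)
qed

section \<open>Closure of the model under the rules\<close>

lemma P_bpt_cases:
  assumes "r \<in> P_bpt A"
  obtains (goal) P where "P \<in> goal_atoms A" "r = Rule (Atom Goal [atom_rep P]) []"
    | (sort) s where "s \<in> sorts A" "r = Rule (Atom Sortname [AFun (ConstName s) []]) []"
    | (may_infer) ax where "ax \<in> axioms A" "r = may_infer_rule ax"
    | (needs) ax p where "ax \<in> axioms A" "p \<in> set (body ax)" "r = needs_rule ax p"
    | (pot_goal) "r = Rule (Atom Pot [AVar ''X'']) [Pos (Atom Goal [AVar ''X''])]"
    | (pot_needs) "r = Rule (Atom Pot [AVar ''P''])
        [Pos (Atom InferenceNeeds [AVar ''_1'', AVar ''_2'', AVar ''P''])]"
  using assms unfolding P_bpt_def P_bos_def P_b_def P_o_def P_s_def by blast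

lemma P_bpt_no_negation: "r \<in> P_bpt A \<Longrightarrow> Naf a \<notin> set (rule_body r)"
  by (erule P_bpt_cases) (auto simp: may_infer_rule_def needs_rule_def)

lemma rewriting_model_closed:
  assumes "inj_on ident (axioms A)"
  shows "rule_closed (P_bpt A) (rewriting_model A)"
  unfolding rule_closed_def
proof (intro ballI allI impI)
  fix r and \<sigma> :: "string \<Rightarrow> ('a, 'b, 'c) aterm"
  assume eqs: "\<forall>s t. Equal s t \<in> set (rule_body r) \<longrightarrow> asp_subst \<sigma> s = asp_subst \<sigma> t"
    and pos: "\<forall>a. Pos a \<in> set (rule_body r) \<longrightarrow> map_atom id (asp_subst \<sigma>) a \<in> rewriting_model A"
  assume "r \<in> P_bpt A"
  then show "map_atom id (asp_subst \<sigma>) (rule_head r) \<in> rewriting_model A"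
  proof (cases rule: P_bpt_cases)
    case (goal P)
    then show ?thesis by (auto simp: in_rewriting_model asp_subst_atom_rep)
  next
    case (sort s)
    then show ?thesis by (auto simp: in_rewriting_model)
  next
    case (may_infer ax)
    have "Atom Pot [asp_subst \<sigma> (schema_rep (head ax))] \<in> rewriting_model A"
      using pos may_infer by (simp add: may_infer_rule_def)
    then obtain P where P: "P \<in> potential A" "asp_subst \<sigma> (schema_rep (head ax)) = atom_rep P"
      by (auto simp: in_rewriting_model)
    then obtain \<theta> where \<theta>: "P = inst \<theta> (head ax)"
      "\<forall>x\<in>set (head_vars ax). \<sigma> x = enc_hterm (\<theta> x)"
      using asp_subst_schema_rep_eq_atom_repD unfolding head_vars_def by blast
    \<comment> \<open>The equality that carries the index of \<open>z\<close> forces the Skolem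
      term: its arguments are the head variables, whose values are known from the match.\<close>
    have "\<sigma> z = enc_hterm (skolemize ax \<theta> z)" if z: "z \<in> set (exist_vars ax)" for z
    proof -
      obtain j where j: "(j, z) \<in> set (List.enumerate 1 (exist_vars ax))"
        using z by (simp add: in_enumerate_iff_takeWhile distinct_exist_vars)
      then have "Equal (AVar z) (s_term (ident ax) j (map AVar (head_vars ax))) \<in> set (rule_body r)"
        by (force simp: may_infer may_infer_rule_def)
      then have "\<sigma> z = asp_subst \<sigma> (s_term (ident ax) j (map AVar (head_vars ax)))"
        using eqs by fastforce
      then show ?thesis
        using \<theta>(2) by (simp add: skolemize_exist_var[OF j] s_term_def)
    qed
    then have "map_atom id (asp_subst \<sigma>) (may_infer_atom ax) = may_infer_inst ax \<theta>"
      using \<theta>(2) by (intro asp_subst_may_infer_atom) (auto simp: skolemize_head_var)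
    moreover have "(ax, \<theta>) \<in> potential_inferences A"
      using may_infer(1) P(1) \<theta>(1) by (simp add: potential_inferences_def)
    ultimately show ?thesis
      by (simp add: may_infer(2) may_infer_rule_def inference_in_rewriting_model)
  next
    case (needs ax p)
    have "map_atom id (asp_subst \<sigma>) (may_infer_atom ax) \<in> rewriting_model A"
      using pos needs by (simp add: needs_rule_def)
    then obtain ax' \<theta> where ax': "(ax', \<theta>) \<in> potential_inferences A"
      "map_atom id (asp_subst \<sigma>) (may_infer_atom ax) = may_infer_inst ax' \<theta>"
      by (auto simp: may_infer_atom_def in_rewriting_model)
    \<comment> \<open>The matched atom might stem from another axiom; its first argument records the
      identifier, and identifiers are unique.\<close>
    then have "ident ax = ident ax'"
      by (simp add: may_infer_atom_def may_infer_inst_def)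
    then have "ax' = ax"
      using ax'(1) needs(1) assms by (auto simp: potential_inferences_def inj_on_def)
    note \<theta> = ax'[unfolded this]
    have "asp_subst \<sigma> (schema_rep p) = atom_rep (inst (skolemize ax \<theta>) p)"
      using may_infer_match[OF \<theta>(2)] needs(2) by (rule asp_subst_body_atom)
    moreover have "asp_subst \<sigma> (schema_rep (head ax)) = atom_rep (inst \<theta> (head ax))"
      using \<theta>(2) by (simp add: may_infer_atom_def may_infer_inst_def)
    ultimately have "map_atom id (asp_subst \<sigma>) (rule_head r) =
        needs_inst ax \<theta> (inst (skolemize ax \<theta>) p)"
      by (simp add: needs needs_rule_def needs_inst_def)
    moreover have "inst (skolemize ax \<theta>) p \<in> body_inst ax \<theta>"
      using needs(2) by (simp add: body_inst_def)
    ultimately show ?thesis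
      using \<theta>(1) by (simp add: inference_in_rewriting_model)
  next
    case pot_goal
    then show ?thesis
      using pos by (auto simp: in_rewriting_model intro: potential.goal)
  next
    case pot_needs
    then have "Atom InferenceNeeds [\<sigma> ''_1'', \<sigma> ''_2'', \<sigma> ''P''] \<in> rewriting_model A"
      using pos by simp
    then obtain ax \<theta> Q where "(ax, \<theta>) \<in> potential_inferences A" "Q \<in> body_inst ax \<theta>"
      "\<sigma> ''P'' = atom_rep Q"
      by (auto simp: in_rewriting_model needs_inst_def)
    then show ?thesis
      by (auto simp: pot_needs in_rewriting_model potential_inferences_def
          intro: potential.backchain)
  qed
qed

section \<open>Minimality of the model\<close>

lemma may_infer_rule_vars:
  "rule_vars (may_infer_rule ax) \<subseteq> set (head_vars ax) \<union> set (exist_vars ax)"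
  by (auto simp: rule_vars_def may_infer_rule_def may_infer_atom_def s_term_def l_term_def
      asp_vars_schema_rep head_vars_def dest!: in_set_enumerate_eq[THEN iffD1])

lemma needs_rule_vars:
  "p \<in> set (body ax) \<Longrightarrow> rule_vars (needs_rule ax p) \<subseteq> set (head_vars ax) \<union> set (exist_vars ax)"
  by (auto simp: rule_vars_def needs_rule_def may_infer_atom_def l_term_def asp_vars_schema_rep
      head_vars_def set_exist_vars set_body_vars)

text \<open>The closure conditions range over substitutions into the Herbrand universe only, which is why
  it has to be checked that the invented terms lie in it.\<close>

lemma skolemize_in_herbrand_universe:
  assumes "ax \<in> axioms A" "atom_rep (inst \<theta> (head ax)) \<in> herbrand_universe (P_bpt A)"
    and "x \<in> set (head_vars ax) \<union> set (exist_vars ax)"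
  shows "enc_hterm (skolemize ax \<theta> x) \<in> herbrand_universe (P_bpt A)"
proof -
  \<comment> \<open>The values of the head variables are subterms of the encoded head.\<close>
  have head: "enc_hterm (\<theta> y) \<in> herbrand_universe (P_bpt A)" if "y \<in> set (head_vars ax)" for y
  proof (rule herbrand_universe_args)
    show "AFun CFun (AFun (PredName (pred (head ax))) [] # map enc_hterm (args (inst \<theta> (head ax))))
        \<in> herbrand_universe (P_bpt A)"
      using assms(2) by (cases "head ax") (simp add: atom_rep_def c_term_def inst_def)
    show "enc_hterm (\<theta> y) \<in>
        set (AFun (PredName (pred (head ax))) [] # map enc_hterm (args (inst \<theta> (head ax))))"
      using that by (cases "head ax") (force simp: head_vars_def in_atom_vars_iff inst_def)
  qed
  show ?thesis
  proof (cases "x \<in> set (head_vars ax)")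
    case True
    then show ?thesis
      using head by (simp add: skolemize_head_var)
  next
    case False
    then obtain j where j: "(j, x) \<in> set (List.enumerate 1 (exist_vars ax))"
      using assms(3) by (simp add: in_enumerate_iff_takeWhile distinct_exist_vars)
    \<comment> \<open>This term occurs in the equality for \<open>x\<close>, so the signature has
      its symbols with the right arities.\<close>
    let ?s = "s_term (ident ax) j (map AVar (head_vars ax))"
    have "asp_subst (enc_hterm \<circ> \<theta>) ?s \<in> herbrand_universe (P_bpt A)"
    proof (rule rule_term_in_herbrand_universe)
      show "may_infer_rule ax \<in> P_bpt A"
        using assms(1) by (auto simp: P_bpt_def P_bos_def P_b_def)
      show "?s \<in> rule_terms (may_infer_rule ax)"
        using j by (force simp: may_infer_rule_def)
      show "(enc_hterm \<circ> \<theta>) y \<in> herbrand_universe (P_bpt A)" if "y \<in> asp_vars ?s" for y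
        using that head by (auto simp: s_term_def)
    qed
    then show ?thesis
      by (simp add: skolemize_exist_var[OF j] s_term_def comp_def)
  qed
qed

text \<open>Replays one back-chaining step inside a closed \<open>J\<close>, through the rules for
  \<open>mayInferVia\<close>, \<open>inferenceNeeds\<close> and \<open>pot\<close> in turn.
  Membership in the Herbrand universe is passed from the head to the body atoms so that steps can be
  iterated.\<close>

lemma potential_inference_in_closed:
  assumes J: "rule_closed (P_bpt A) J" and ax: "ax \<in> axioms A"
    and hu: "atom_rep (inst \<theta> (head ax)) \<in> herbrand_universe (P_bpt A)"
    and pot: "Atom Pot [atom_rep (inst \<theta> (head ax))] \<in> J"
  shows "may_infer_inst ax \<theta> \<in> J"
    and "Q \<in> body_inst ax \<theta> \<Longrightarrow> needs_inst ax \<theta> Q \<in> J"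
    and "Q \<in> body_inst ax \<theta> \<Longrightarrow> atom_rep Q \<in> herbrand_universe (P_bpt A)"
    and "Q \<in> body_inst ax \<theta> \<Longrightarrow> Atom Pot [atom_rep Q] \<in> J"
proof -
  let ?\<Pi> = "P_bpt A"
  define \<sigma> :: "string \<Rightarrow> ('a, 'b, 'c) aterm" where "\<sigma> = (\<lambda>x. enc_hterm (skolemize ax \<theta> x))"
  have \<sigma>_hu: "\<sigma> x \<in> herbrand_universe ?\<Pi>" if "x \<in> set (head_vars ax) \<union> set (exist_vars ax)" for x
    unfolding \<sigma>_def using ax hu that by (rule skolemize_in_herbrand_universe)
  have head: "asp_subst \<sigma> (schema_rep (head ax)) = atom_rep (inst \<theta> (head ax))"
    unfolding asp_subst_schema_rep_eq_iff head_vars_def[symmetric]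
    by (simp add: \<sigma>_def skolemize_head_var)
  have mi: "map_atom id (asp_subst \<sigma>) (may_infer_atom ax) = may_infer_inst ax \<theta>"
    by (rule asp_subst_may_infer_atom) (simp add: \<sigma>_def)
  have mi_in: "may_infer_rule ax \<in> ?\<Pi>"
    using ax by (auto simp: P_bpt_def P_bos_def P_b_def)
  show 1: "may_infer_inst ax \<theta> \<in> J"
    unfolding mi[symmetric]
  proof (rule rule_closedD[OF J mi_in[unfolded may_infer_rule_def]], goal_cases)
    case (1 x)
    then show ?case
      using \<sigma>_hu may_infer_rule_vars unfolding may_infer_rule_def by blast
  next
    \<comment> \<open>\<open>\<sigma>\<close> sends \<open>z\<close> to the Skolem term with exactly
      the index that the enumeration gives it.\<close>
    case (2 s t)
    then obtain j z where j: "(j, z) \<in> set (List.enumerate 1 (exist_vars ax))"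
      and st: "s = AVar z" "t = s_term (ident ax) j (map AVar (head_vars ax))"
      by auto
    then show ?case
      by (simp add: \<sigma>_def skolemize_exist_var[OF j] s_term_def skolemize_head_var)
  next
    case (3 a)
    then have "a = Atom Pot [schema_rep (head ax)]" by auto
    then show ?case
      using pot head by simp
  qed
  assume "Q \<in> body_inst ax \<theta>"
  then obtain p where p: "p \<in> set (body ax)" "Q = inst (skolemize ax \<theta>) p"
    by (auto simp: body_inst_def)
  have Q: "asp_subst \<sigma> (schema_rep p) = atom_rep Q"
    unfolding p(2) by (rule asp_subst_body_atom[OF _ p(1)]) (simp add: \<sigma>_def)
  have needs_in: "needs_rule ax p \<in> ?\<Pi>"
    using ax p by (auto simp: P_bpt_def P_bos_def P_b_def)
  have n: "needs_inst ax \<theta> Q = map_atom id (asp_subst \<sigma>)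
      (Atom InferenceNeeds [schema_rep (head ax), AFun (AxiomName (ident ax)) [], schema_rep p])"
    by (simp add: needs_inst_def head Q)
  show 2: "needs_inst ax \<theta> Q \<in> J"
    unfolding n
  proof (rule rule_closedD[OF J needs_in[unfolded needs_rule_def]], goal_cases)
    case (1 x)
    then show ?case
      using \<sigma>_hu needs_rule_vars[OF p(1)] unfolding needs_rule_def by blast
  next
    case (3 a)
    then show ?case
      using 1 mi by simp
  qed simp
  show 3: "atom_rep Q \<in> herbrand_universe ?\<Pi>"
    unfolding Q[symmetric]
  proof (rule rule_term_in_herbrand_universe[OF needs_in])
    show "schema_rep p \<in> rule_terms (needs_rule ax p)"
      by (simp add: needs_rule_def)
    show "\<sigma> x \<in> herbrand_universe ?\<Pi>" if "x \<in> asp_vars (schema_rep p)" for x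
      using that p(1) by (intro \<sigma>_hu) (auto simp: asp_vars_schema_rep set_exist_vars set_body_vars)
  qed
  have pot_in: "Rule (Atom Pot [AVar ''P''])
      [Pos (Atom InferenceNeeds [AVar ''_1'', AVar ''_2'', AVar ''P''])] \<in> ?\<Pi>"
    by (simp add: P_bpt_def)
  have ident_hu: "AFun (AxiomName (ident ax)) [] \<in> herbrand_universe ?\<Pi>"
    using rule_term_in_herbrand_universe[OF needs_in, of "AFun (AxiomName (ident ax)) []" \<sigma>]
    by (simp add: needs_rule_def)
  \<comment> \<open>The anonymous variables receive the first two arguments of
    \<open>needs_inst ax \<theta> Q\<close>; every other variable, in particular
    \<open>''P''\<close>, receives the encoding of \<open>Q\<close>.\<close>
  define \<tau> :: "string \<Rightarrow> ('a, 'b, 'c) aterm" where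
    "\<tau> = (\<lambda>x. atom_rep Q)(''_1'' := atom_rep (inst \<theta> (head ax)), ''_2'' := AFun (AxiomName (ident ax)) [])"
  have "map_atom id (asp_subst \<tau>) (Atom Pot [AVar ''P'']) \<in> J"
  proof (rule rule_closedD[OF J pot_in], goal_cases)
    case (1 x)
    then show ?case
      using 3 hu ident_hu by (simp add: \<tau>_def)
  next
    case (3 a)
    then show ?case
      using 2 by (simp add: \<tau>_def needs_inst_def)
  qed simp
  then show "Atom Pot [atom_rep Q] \<in> J"
    by (simp add: \<tau>_def)
qed

lemma goal_in_closed:
  assumes "rule_closed (P_bpt A) J" "P \<in> goal_atoms A"
  shows "Atom Goal [atom_rep P] \<in> J"
    and "atom_rep P \<in> herbrand_universe (P_bpt A)"
    and "Atom Pot [atom_rep P] \<in> J"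
proof -
  have goal_in: "Rule (Atom Goal [atom_rep P]) [] \<in> P_bpt A"
    using assms(2) by (auto simp: P_bpt_def P_bos_def P_o_def)
  \<comment> \<open>The fact is ground, so any substitution serves; \<open>AVar\<close> is the
    identity.\<close>
  show 1: "Atom Goal [atom_rep P] \<in> J"
    using rule_closedD[OF assms(1) goal_in, of AVar]
    by (simp add: rule_vars_def asp_vars_atom_rep asp_subst_atom_rep)
  show 2: "atom_rep P \<in> herbrand_universe (P_bpt A)"
    using rule_term_in_herbrand_universe[OF goal_in, of "atom_rep P" AVar]
    by (simp add: asp_vars_atom_rep asp_subst_atom_rep)
  have pot_in: "Rule (Atom Pot [AVar ''X'']) [Pos (Atom Goal [AVar ''X''])] \<in> P_bpt A"
    by (simp add: P_bpt_def)
  show "Atom Pot [atom_rep P] \<in> J"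
    using rule_closedD[OF assms(1) pot_in, of "\<lambda>_. atom_rep P"] 1 2 by simp
qed

lemma potential_in_closed:
  assumes "rule_closed (P_bpt A) J" "P \<in> potential A"
  shows "atom_rep P \<in> herbrand_universe (P_bpt A) \<and> Atom Pot [atom_rep P] \<in> J"
  using assms(2)
proof induction
  case (goal P)
  then show ?case
    using goal_in_closed[OF assms(1)] by blast
next
  case (backchain ax \<theta> Q)
  then show ?case
    using potential_inference_in_closed(3,4)[OF assms(1)] by blast
qed

lemma rewriting_model_least:
  assumes "rule_closed (P_bpt A) J"
  shows "rewriting_model A \<subseteq> J"
proof -
  have "Atom Sortname [AFun (ConstName s) []] \<in> J" if "s \<in> sorts A" for s
  proof -
    have "Rule (Atom Sortname [AFun (ConstName s) []]) [] \<in> P_bpt A"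
      using that by (auto simp: P_bpt_def P_bos_def P_s_def)
    from rule_closedD[OF assms this, of AVar] show ?thesis
      by (simp add: rule_vars_def)
  qed
  moreover have "may_infer_inst ax \<theta> \<in> J" "Q \<in> body_inst ax \<theta> \<Longrightarrow> needs_inst ax \<theta> Q \<in> J"
    if "(ax, \<theta>) \<in> potential_inferences A" for ax \<theta> Q
    using that potential_in_closed[OF assms] potential_inference_in_closed(1,2)[OF assms]
    unfolding potential_inferences_def by blast+
  ultimately show ?thesis
    using goal_in_closed(1)[OF assms] potential_in_closed[OF assms]
    unfolding rewriting_model_def by auto
qed

text \<open>Both kinds of atoms stem from \<open>potential_inferences A\<close>, which also
  underlies the edges. The inference behind an edge supplies the witnesses \<open>r\<close> and
  \<open>l\<close>.\<close>

lemma rewriting_model_edges: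
  "{(t', t). \<exists>r l. Atom MayInferVia [r, t, l] \<in> rewriting_model A \<and>
      Atom InferenceNeeds [t, r, t'] \<in> rewriting_model A} =
    map_prod atom_rep atom_rep ` potential_edges A" (is "?L = ?R")
proof (intro equalityI subsetI)
  fix e assume "e \<in> ?L"
  then obtain t t' r where e: "e = (t', t)" "Atom InferenceNeeds [t, r, t'] \<in> rewriting_model A"
    by blast
  then obtain ax \<theta> Q where "(ax, \<theta>) \<in> potential_inferences A" "Q \<in> body_inst ax \<theta>"
    "t = atom_rep (inst \<theta> (head ax))" "t' = atom_rep Q"
    by (auto simp: in_rewriting_model needs_inst_def)
  then show "e \<in> ?R"
    by (force simp: e(1) potential_edges_def potential_inferences_def)
next
  fix e assume "e \<in> ?R"
  then obtain ax \<theta> Q where e: "e = (atom_rep Q, atom_rep (inst \<theta> (head ax)))"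
    "(ax, \<theta>) \<in> potential_inferences A" "Q \<in> body_inst ax \<theta>"
    by (auto simp: potential_edges_def potential_inferences_def)
  then have "may_infer_inst ax \<theta> \<in> rewriting_model A" "needs_inst ax \<theta> Q \<in> rewriting_model A"
    by (simp_all add: inference_in_rewriting_model)
  then show "e \<in> ?L"
    unfolding e(1) may_infer_inst_def needs_inst_def by blast
qed

theorem lemma1:
  fixes A :: "('p, 'c, 'i) abduction"
  assumes "abduction_instance A"
  shows "\<exists>I. (\<forall>J. answer_set (P_bpt A) J \<longleftrightarrow> J = I) \<and>
    {t. Atom Pot [t] \<in> I} = atom_rep ` (\<Union>G\<in>backchaining_proof_graphs A. fst G) \<and>
    {(t', t). \<exists>r l. Atom MayInferVia [r, t, l] \<in> I \<and> Atom InferenceNeeds [t, r, t'] \<in> I} =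
      map_prod atom_rep atom_rep ` (\<Union>G\<in>backchaining_proof_graphs A. snd G)"
proof (intro exI conjI allI)
  have inj: "inj_on ident (axioms A)" and acyc: "acyclic (feeds (axioms A))"
    using assms unfolding abduction_instance_def by blast+
  show "answer_set (P_bpt A) J \<longleftrightarrow> J = rewriting_model A" for J
    using P_bpt_no_negation rewriting_model_closed[OF inj] rewriting_model_least
    by (rule answer_set_iff_least_closed)
  show "{t. Atom Pot [t] \<in> rewriting_model A} =
      atom_rep ` (\<Union>G\<in>backchaining_proof_graphs A. fst G)"
    unfolding backchaining_proof_graphs_nodes[OF acyc] by (auto simp: in_rewriting_model)
  show "{(t', t). \<exists>r l. Atom MayInferVia [r, t, l] \<in> rewriting_model A \<and>
      Atom InferenceNeeds [t, r, t'] \<in> rewriting_model A} =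
      map_prod atom_rep atom_rep ` (\<Union>G\<in>backchaining_proof_graphs A. snd G)"
    unfolding backchaining_proof_graphs_edges[OF acyc] by (rule rewriting_model_edges)
qed

end
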